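(* Let $K_1,\dots,K_d$ be a basis of a $d$-dimensional linear subspace $\mathcal L$ of the space of real symmetric $m\times m$ matrices, let $\Theta=\{\Sigma\in\mathrm{PD}_m:\Sigma^{-1}\in\mathcal L\}$ be the associated linear concentration model, and let $\Sigma\in\Theta$. Then $$\log\mathrm{Vor}_\Theta(\Sigma)=\mathcal K_\Theta(\Sigma)=\{S\in\mathrm{PD}_m:\ \mathrm{tr}(SK_j)=\mathrm{tr}(\Sigma K_j),\ j=1,\dots,d\}.$$
   Context: $\mathrm{PD}_m$ is the cone of real symmetric positive definite $m\times m$ matrices. A positive integer $n$ is fixed. The log-likelihood function is $$\ell_n(\Sigma,S)=-\tfrac n2\log\det\Sigma-\tfrac n2\mathrm{tr}(S\Sigma^{-1}).$$ For a model $\Theta\subseteq\mathrm{PD}_m$ and $\Sigma\in\Theta$, the logarithmic Voronoi cell is $\log\mathrm{Vor}_\Theta(\Sigma)=\{S\in\mathrm{PD}_m:\ \ell_n(\Sigma,S)\ge \ell_n(\Sigma',S)\text{ for all }\Sigma'\in\Theta\}$. A point $\Sigma$ of $\Theta$ is a critical point of $\ell_n(\cdot,S)$ on $\Theta$ if the gradient of $\ell_n(\cdot,S)$ at $\Sigma$ lies in the normal space of $\Theta$ at $\Sigma$ (the orthogonal complement, with respect to the trace inner product on symmetric matrices, of the tangent space of $\Theta$ at $\Sigma$). The log-normal matrix space $\mathcal N_\Sigma\Theta$ is the affine linear space of all real symmetric $m\times m$ matrices $S$ such that $\Sigma$ is a critical point of $\ell_n(\cdot,S)$ on $\Theta$.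 The log-normal spectrahedron at $\Sigma$ is $\mathcal K_\Theta(\Sigma)=\mathrm{PD}_m\cap\mathcal N_\Sigma\Theta$. *)

theory Defs
  imports "HOL-Analysis.Analysis"
begin

definition Sym :: "(real^'m^'m) set" where
  "Sym = {A. transpose A = A}"

definition PD :: "(real^'m^'m) set" where
  "PD = {A \<in> Sym. \<forall>x. x \<noteq> 0 \<longrightarrow> x \<bullet> (A *v x) > 0}"

definition log_lik :: "nat \<Rightarrow> real^'m^'m \<Rightarrow> real^'m^'m \<Rightarrow> real" where
  "log_lik n \<Sigma> S =
     - (real n / 2) * ln (det \<Sigma>) - (real n / 2) * trace (S ** matrix_inv \<Sigma>)"

definition log_Vor :: "nat \<Rightarrow> (real^'m^'m) set \<Rightarrow> real^'m^'m \<Rightarrow> (real^'m^'m) set" where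
  "log_Vor n \<Theta> \<Sigma> = {S \<in> PD. \<forall>\<Sigma>'\<in>\<Theta>. log_lik n \<Sigma> S \<ge> log_lik n \<Sigma>' S}"

text \<open>
  Velocities at \<open>\<Sigma>\<close> of \<open>C\<^sup>1\<close> curves running inside \<open>\<Theta>\<close>. This is the usual tangent space
  when \<open>\<Theta>\<close> is an embedded submanifold near \<open>\<Sigma>\<close>, which is the intended use; nothing
  is claimed for singular points.
\<close>
definition tangent_space :: "(real^'m^'m) set \<Rightarrow> real^'m^'m \<Rightarrow> (real^'m^'m) set" where
  "tangent_space \<Theta> \<Sigma> =
     {vector_derivative \<gamma> (at 0) | \<gamma> :: real \<Rightarrow> real^'m^'m.
        \<gamma> 0 = \<Sigma> \<and>
        (\<exists>e>0. \<gamma> C1_differentiable_on {-e<..<e} \<and> \<gamma> ` {-e<..<e} \<subseteq> \<Theta>)}"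

definition normal_space :: "(real^'m^'m) set \<Rightarrow> real^'m^'m \<Rightarrow> (real^'m^'m) set" where
  "normal_space \<Theta> \<Sigma> = {N \<in> Sym. \<forall>T\<in>tangent_space \<Theta> \<Sigma>. trace (N ** T) = 0}"

text \<open>
  Gradient of a function on the cone \<open>PD\<close>, with respect to the trace inner product on
  \<open>Sym\<close>. Since \<open>PD\<close> is open in \<open>Sym\<close>, requiring \<open>G \<in> Sym\<close> makes \<open>G\<close> unique; values of
  \<open>f\<close> outside \<open>PD\<close> play no role.
\<close>
definition has_sym_gradient ::
    "(real^'m^'m \<Rightarrow> real) \<Rightarrow> real^'m^'m \<Rightarrow> real^'m^'m \<Rightarrow> bool" where
  "has_sym_gradient f G \<Sigma> \<longleftrightarrow>
     G \<in> Sym \<and> (f has_derivative (\<lambda>H. trace (G ** H))) (at \<Sigma> within PD)"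

definition critical_point ::
    "(real^'m^'m \<Rightarrow> real) \<Rightarrow> (real^'m^'m) set \<Rightarrow> real^'m^'m \<Rightarrow> bool" where
  "critical_point f \<Theta> \<Sigma> \<longleftrightarrow>
     \<Sigma> \<in> \<Theta> \<and> (\<exists>G. has_sym_gradient f G \<Sigma> \<and> G \<in> normal_space \<Theta> \<Sigma>)"

definition log_normal_space :: "nat \<Rightarrow> (real^'m^'m) set \<Rightarrow> real^'m^'m \<Rightarrow> (real^'m^'m) set" where
  "log_normal_space n \<Theta> \<Sigma> = {S \<in> Sym. critical_point (\<lambda>\<Sigma>'. log_lik n \<Sigma>' S) \<Theta> \<Sigma>}"

definition log_normal_spectrahedron ::
    "nat \<Rightarrow> (real^'m^'m) set \<Rightarrow> real^'m^'m \<Rightarrow> (real^'m^'m) set" where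
  "log_normal_spectrahedron n \<Theta> \<Sigma> = PD \<inter> log_normal_space n \<Theta> \<Sigma>"

definition concentration_model :: "(real^'m^'m) set \<Rightarrow> (real^'m^'m) set" where
  "concentration_model L = {\<Sigma> \<in> PD. matrix_inv \<Sigma> \<in> L}"

end

theory Submission
  imports Defs
begin

text \<open>
  The proof works in the concentration coordinate \<open>A = \<Sigma>\<^sup>-\<^sup>1\<close>, in which the model is the slice
  \<open>PD \<inter> L\<close> of a linear space and the log-likelihood becomes
  \<open>n/2 (ln det A - tr (S A))\<close>. Its derivative at \<open>A\<close> in a direction \<open>K \<in> L\<close> is
  \<open>n/2 (tr (\<Sigma> K) - tr (S K))\<close>. So both "\<open>\<Sigma>\<close> maximizes the likelihood" and "\<open>\<Sigma>\<close> is a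
  critical point" should amount to \<open>tr (S K) = tr (\<Sigma> K)\<close> for all \<open>K \<in> L\<close>, which by linearity
  needs to be tested on a basis only.

  For the maximizer (\<open>maximizer_iff_trace_eq\<close>), necessity is the first order condition along
  \<open>A + t K\<close>, which stays in the model for small \<open>t\<close>. Sufficiency is concavity of \<open>ln det\<close>, in the form
  \<open>ln det B - ln det A \<le> tr (A\<^sup>-\<^sup>1 (B - A))\<close> (\<open>ln_det_le_tangent\<close>): it comes from the mean
  value theorem and the fact that \<open>tr ((A + t D)\<^sup>-\<^sup>1 D)\<close> does not increase with \<open>t\<close>, and this in
  turn from \<open>tr (N P) \<ge> 0\<close> for positive semidefinite \<open>N\<close> and \<open>P\<close> (\<open>trace_mult_psd_nonneg\<close>).

  For critical points (\<open>critical_point_iff_trace_eq\<close>), the tangent space is the image of \<open>L\<close>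
  under the derivative \<open>K \<mapsto> -\<Sigma> K \<Sigma>\<close> of matrix inversion
  (\<open>tangent_space_concentration_model\<close>), and the gradient of the log-likelihood is
  \<open>-n/2 (\<Sigma>\<^sup>-\<^sup>1 - \<Sigma>\<^sup>-\<^sup>1 S \<Sigma>\<^sup>-\<^sup>1)\<close>; pairing the two gives \<open>n/2 (tr (\<Sigma> K) - tr (S K))\<close> again.
\<close>

section \<open>Matrix calculus\<close>

lemma matrix_mult_scaleR_left: "(c *\<^sub>R A) ** B = c *\<^sub>R (A ** (B :: real^'k^'n))"
  by (simp add: matrix_matrix_mult_def vec_eq_iff sum_distrib_left mult.assoc)

lemma matrix_mult_scaleR_right: "A ** (c *\<^sub>R B) = c *\<^sub>R (A ** (B :: real^'k^'n))"
  by (simp add: matrix_matrix_mult_def vec_eq_iff sum_distrib_left mult.left_commute)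

lemma matrix_mult_diff_left: "(A - B) ** C = A ** C - B ** (C :: real^'k^'n)"
  by (simp add: matrix_matrix_mult_def vec_eq_iff left_diff_distrib sum_subtractf)

lemma matrix_mult_diff_right: "A ** (B - C) = A ** B - A ** (C :: real^'k^'n)"
  by (simp add: matrix_matrix_mult_def vec_eq_iff right_diff_distrib sum_subtractf)

lemma matrix_mult_uminus_left: "(- A) ** B = - (A ** (B :: real^'k^'n))"
  using matrix_mult_scaleR_left[of "-1" A B] by simp

lemma matrix_mult_uminus_right: "A ** (- B) = - (A ** (B :: real^'k^'n))"
  using matrix_mult_scaleR_right[of A "-1" B] by simp

lemma matrix_mult_add_left: "(A + B) ** C = A ** C + B ** (C :: real^'k^'n)"
  by (simp add: matrix_matrix_mult_def vec_eq_iff distrib_right sum.distrib)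

lemma bounded_bilinear_matrix_mult:
  "bounded_bilinear (\<lambda>(A :: real^'n^'m) (B :: real^'k^'n). A ** B)"
  unfolding bilinear_conv_bounded_bilinear[symmetric]
  by (auto simp: bilinear_def matrix_mult_scaleR_left matrix_mult_scaleR_right
      matrix_add_ldistrib matrix_mult_add_left intro!: linearI)

lemma trace_scaleR: "trace (c *\<^sub>R (A :: real^'n^'n)) = c * trace A"
  by (simp add: trace_def sum_distrib_left)

lemma trace_uminus: "trace (- (A :: real^'n^'n)) = - trace A"
  by (simp add: trace_def sum_negf)

lemma bounded_linear_trace: "bounded_linear (trace :: real^'n^'n \<Rightarrow> real)"
  unfolding linear_conv_bounded_linear[symmetric]
  by (rule linearI) (simp_all add: trace_add trace_scaleR)

lemmas has_derivative_matrix_mult = bounded_bilinear.FDERIV[OF bounded_bilinear_matrix_mult]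

lemmas has_derivative_trace = bounded_linear.has_derivative[OF bounded_linear_trace]

text \<open>
  Row \<open>i\<close> of \<open>B ** A\<close> is a combination of the rows of \<open>A\<close>, and only its multiple of row \<open>i\<close>
  itself contributes to the determinant.
\<close>

lemma det_replace_row:
  fixes A B :: "real^'n^'n"
  shows "det (\<chi> k. if k = i then row i (B ** A) else row k A) = B $ i $ i * det A"
proof -
  have row_eq: "row i (B ** A) = (\<Sum>k\<in>UNIV. B $ i $ k *s row k A)"
    by (simp add: vec_eq_iff row_def matrix_matrix_mult_def)
  show ?thesis
    unfolding row_eq by (rule cramer_lemma_transpose)
qed

text \<open>
  The determinant is linear in each row, so its derivative replaces one row at a time. This form
  also holds at singular matrices.
\<close>

lemma has_derivative_det:
  fixes A :: "real^'n^'n"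
  shows "(det has_derivative (\<lambda>H. \<Sum>i\<in>UNIV. det (\<chi> k. if k = i then row i H else row k A))) (at A)"
proof -
  let ?P = "{p. p permutes (UNIV :: 'n set)}"
  have entry: "((\<lambda>X :: real^'n^'n. X $ i $ j) has_derivative (\<lambda>H. H $ i $ j)) (at A)" for i j
    by (intro bounded_linear_imp_has_derivative
        bounded_linear_compose[OF bounded_linear_vec_nth bounded_linear_vec_nth])
  have "(det has_derivative (\<lambda>H. \<Sum>p\<in>?P. of_int (sign p) *
          (\<Sum>i\<in>UNIV. H $ i $ p i * (\<Prod>j\<in>UNIV - {i}. A $ j $ p j)))) (at A)"
    unfolding det_def[abs_def]
    by (intro has_derivative_sum has_derivative_mult_right has_derivative_prod entry)
  moreover have "(\<Sum>p\<in>?P. of_int (sign p) *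
          (\<Sum>i\<in>UNIV. H $ i $ p i * (\<Prod>j\<in>UNIV - {i}. A $ j $ p j)))
      = (\<Sum>i\<in>UNIV. det (\<chi> k. if k = i then row i H else row k A))" for H
  proof -
    have "(\<Prod>j\<in>UNIV. (if j = i then row i H else row j A) $ p j)
        = H $ i $ p i * (\<Prod>j\<in>UNIV - {i}. A $ j $ p j)" for i and p :: "'n \<Rightarrow> 'n"
      by (subst prod.remove[of _ i]) (auto simp: row_def intro!: prod.cong)
    then show ?thesis
      unfolding det_def sum_distrib_left by (subst sum.swap) simp
  qed
  ultimately show ?thesis by simp
qed

lemma matrix_inv_unique:
  fixes A B :: "real^'n^'n"
  assumes "A ** B = mat 1"
  shows "matrix_inv A = B"
proof -
  have BA: "B ** A = mat 1"
    using assms matrix_left_right_inverse by blast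
  have "A ** matrix_inv A = mat 1 \<and> matrix_inv A ** A = mat 1"
    unfolding matrix_inv_def by (rule someI[of _ B]) (use assms BA in simp)
  then show ?thesis
    by (metis BA matrix_mul_assoc matrix_mul_lid matrix_mul_rid)
qed

lemma
  fixes A :: "real^'n^'n"
  assumes "det A \<noteq> 0"
  shows matrix_mult_inv_right: "A ** matrix_inv A = mat 1"
    and matrix_mult_inv_left: "matrix_inv A ** A = mat 1"
proof -
  obtain B where "A ** B = mat 1"
    using assms invertible_right_inverse invertible_det_nz by blast
  then show "A ** matrix_inv A = mat 1" "matrix_inv A ** A = mat 1"
    using matrix_inv_unique matrix_left_right_inverse by metis+
qed

text \<open>
  Writing \<open>H = (H A\<^sup>-\<^sup>1) A\<close> turns each determinant with a replaced row into a diagonal entry of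
  \<open>H A\<^sup>-\<^sup>1\<close> times \<open>det A\<close>.
\<close>

lemma Jacobi_formula:
  fixes A :: "real^'n^'n"
  assumes "det A \<noteq> 0"
  shows "(det has_derivative (\<lambda>H. det A * trace (matrix_inv A ** H))) (at A)"
proof -
  have "(\<Sum>i\<in>UNIV. det (\<chi> k. if k = i then row i H else row k A))
      = det A * trace (matrix_inv A ** H)" for H
  proof -
    have H: "H ** matrix_inv A ** A = H"
      using matrix_mult_inv_left[OF assms] by (simp flip: matrix_mul_assoc)
    have "det (\<chi> k. if k = i then row i H else row k A) = (H ** matrix_inv A) $ i $ i * det A" for i
      using det_replace_row[of i "H ** matrix_inv A" A] by (simp only: H)
    then show ?thesis
      by (simp add: trace_mul_sym[of "matrix_inv A"]) (simp add: trace_def sum_distrib_left mult.commute)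
  qed
  then show ?thesis
    using has_derivative_det[of A] by simp
qed

lemma differentiable_det: "det differentiable (at (A :: real^'n^'n))"
  using has_derivative_det differentiable_def by blast

lemma continuous_on_det: "continuous_on S (det :: real^'n^'n \<Rightarrow> real)"
  by (meson continuous_at_imp_continuous_on differentiable_det differentiable_imp_continuous_within)

lemma open_det_nonzero: "open {A :: real^'n^'n. det A \<noteq> 0}"
  by (intro open_Collect_neq continuous_on_det continuous_intros)

text \<open>
  Cramer's rule expresses the entries of the inverse as quotients of determinants whose matrices
  depend affinely on \<open>A\<close>.
\<close>

lemma differentiable_matrix_inv:
  fixes A :: "real^'n^'n"
  assumes "det A \<noteq> 0"
  shows "matrix_inv differentiable (at A)"
proof -
  define C :: "'n \<Rightarrow> 'n \<Rightarrow> real^'n^'n \<Rightarrow> real^'n^'n"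
    where "C l k X = (\<chi> i j. if j = k then axis l 1 $ i else X $ i $ j)" for l k X
  define R :: "real^'n^'n \<Rightarrow> real^'n^'n" where "R X = (\<chi> k l. det (C l k X) / det X)" for X
  have inv_eq: "matrix_inv X = R X" if "det X \<noteq> 0" for X
  proof -
    have "(X ** R X) $ i $ l = (mat 1 :: real^'n^'n) $ i $ l" for i l
    proof -
      have "X *v (\<chi> k. det (C l k X) / det X) = axis l 1"
        using cramer[OF that] unfolding C_def by blast
      from arg_cong[OF this, of "\<lambda>v. v $ i"] show ?thesis
        by (simp add: R_def matrix_matrix_mult_def matrix_vector_mult_def axis_def mat_def)
    qed
    then show ?thesis
      by (intro matrix_inv_unique) (simp add: vec_eq_iff)
  qed
  have C_diff: "C l k differentiable (at A)" for l k
  proof -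
    define f :: "real^'n^'n \<Rightarrow> real^'n^'n"
      where "f X = (\<chi> i j. if j = k then 0 else X $ i $ j)" for X
    have "linear f"
      by (rule linearI) (simp_all add: f_def vec_eq_iff)
    then have "(\<lambda>X. C l k 0 + f X) differentiable (at A)"
      by (intro differentiable_add differentiable_const linear_imp_differentiable)
    moreover have "(\<lambda>X. C l k 0 + f X) = C l k"
      by (simp add: C_def f_def vec_eq_iff fun_eq_iff)
    ultimately show ?thesis by simp
  qed
  have entry: "(\<lambda>X. det (C l k X) / det X) differentiable (at A)" for l k
    using differentiable_chain_at[OF C_diff differentiable_det] assms
    by (intro differentiable_divide differentiable_det) (auto simp: o_def)
  have "R differentiable (at A)"
  proof -
    have "R X \<bullet> axis k (axis l 1) = det (C l k X) / det X" for X k l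
      by (simp add: R_def inner_axis)
    then show ?thesis
      using entry by (subst differentiable_componentwise_within) (auto simp: Basis_vec_def)
  qed
  then obtain R' where "(R has_derivative R') (at A)"
    using differentiable_def by blast
  then have "(matrix_inv has_derivative R') (at A)"
    using open_det_nonzero
    by (rule has_derivative_transform_within_open) (use assms inv_eq in auto)
  then show ?thesis
    using differentiable_def by blast
qed

text \<open>
  Once inversion is known to be differentiable, differentiating \<open>X X\<^sup>-\<^sup>1 = 1\<close> determines its
  derivative.
\<close>

lemma has_derivative_matrix_inv:
  fixes A :: "real^'n^'n"
  assumes "det A \<noteq> 0"
  shows "(matrix_inv has_derivative (\<lambda>H. - (matrix_inv A ** H ** matrix_inv A))) (at A)"
proof -
  obtain D where D: "(matrix_inv has_derivative D) (at A)"
    using differentiable_matrix_inv[OF assms] differentiable_def by blast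
  have "((\<lambda>X. X ** matrix_inv X) has_derivative (\<lambda>H. A ** D H + H ** matrix_inv A)) (at A)"
    by (rule has_derivative_matrix_mult[OF has_derivative_ident D])
  moreover have "((\<lambda>X. X ** matrix_inv X) has_derivative (\<lambda>H. 0)) (at A)"
    by (rule has_derivative_transform_within_open[OF has_derivative_const[of "mat 1"] open_det_nonzero])
      (simp_all add: assms matrix_mult_inv_right)
  ultimately have "(\<lambda>H. A ** D H + H ** matrix_inv A) = (\<lambda>H. 0)"
    by (rule has_derivative_unique)
  then have AD: "A ** D H = - (H ** matrix_inv A)" for H
    by (metis add_eq_0_iff2)
  have "D H = - (matrix_inv A ** H ** matrix_inv A)" for H
  proof -
    have "D H = matrix_inv A ** (A ** D H)"
      by (simp add: matrix_mul_assoc matrix_mult_inv_left[OF assms])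
    then show ?thesis
      by (simp add: AD matrix_mult_uminus_right matrix_mul_assoc)
  qed
  then have "D = (\<lambda>H. - (matrix_inv A ** H ** matrix_inv A))"
    by blast
  with D show ?thesis by simp
qed

section \<open>Positive definite matrices\<close>

lemma SymD: "A \<in> Sym \<Longrightarrow> transpose A = A"
  by (simp add: Sym_def)

lemma subspace_Sym: "subspace (Sym :: (real^'m^'m) set)"
  by (auto simp: subspace_def Sym_def transpose_def vec_eq_iff)

lemma inner_matrix_vector_left:
  fixes A :: "real^'m^'m"
  shows "x \<bullet> (A *v y) = (transpose A *v x) \<bullet> y"
  by (metis dot_lmul_matrix vector_transpose_matrix transpose_transpose)

lemma Sym_inner: "A \<in> Sym \<Longrightarrow> x \<bullet> (A *v y) = y \<bullet> (A *v x)"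
  using inner_matrix_vector_left[of x A y] by (simp only: SymD inner_commute)

lemma PD_imp_Sym: "A \<in> PD \<Longrightarrow> A \<in> Sym"
  by (simp add: PD_def)

lemma PD_pos: "A \<in> PD \<Longrightarrow> x \<noteq> 0 \<Longrightarrow> x \<bullet> (A *v x) > 0"
  by (simp add: PD_def)

lemma PD_nonneg: "A \<in> PD \<Longrightarrow> x \<bullet> (A *v x) \<ge> 0"
  by (cases "x = 0") (auto intro: less_imp_le PD_pos)

lemma PD_det_nonzero:
  assumes "A \<in> PD"
  shows "det A \<noteq> 0"
proof -
  have "x = 0" if "A *v x = 0" for x
    using PD_pos[OF assms, of x] that by fastforce
  then show ?thesis
    by (metis invertible_det_nz invertible_left_inverse matrix_left_invertible_ker)
qed

lemma PD_matrix_inv: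
  assumes "A \<in> PD"
  shows "matrix_inv A \<in> PD"
proof -
  note inv = matrix_mult_inv_right[OF PD_det_nonzero[OF assms]]
  have "transpose (matrix_inv A) = matrix_inv A"
  proof (rule matrix_inv_unique[symmetric])
    have "transpose (matrix_inv A ** A) = mat 1"
      using matrix_mult_inv_left[OF PD_det_nonzero[OF assms]] by simp
    then show "A ** transpose (matrix_inv A) = mat 1"
      by (simp add: matrix_transpose_mul SymD[OF PD_imp_Sym[OF assms]])
  qed
  moreover have "x \<bullet> (matrix_inv A *v x) > 0" if "x \<noteq> 0" for x
  proof -
    define y where "y = matrix_inv A *v x"
    have x: "A *v y = x"
      by (simp add: y_def matrix_vector_mul_assoc inv)
    with that have "y \<noteq> 0" by auto
    then show ?thesis
      using PD_pos[OF assms, of y] by (simp add: inner_commute x y_def[symmetric])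
  qed
  ultimately show ?thesis
    by (simp add: PD_def Sym_def)
qed

lemma PD_convex: "convex (PD :: (real^'m^'m) set)"
proof (rule convexI)
  fix A B :: "real^'m^'m" and u v :: real
  assume *: "A \<in> PD" "B \<in> PD" "0 \<le> u" "0 \<le> v" "u + v = 1"
  have "u *\<^sub>R A + v *\<^sub>R B \<in> Sym"
    using * by (intro subspace_add subspace_scale subspace_Sym PD_imp_Sym)
  moreover have "x \<bullet> ((u *\<^sub>R A + v *\<^sub>R B) *v x) > 0" if "x \<noteq> 0" for x
  proof -
    have "x \<bullet> ((u *\<^sub>R A + v *\<^sub>R B) *v x) = u * (x \<bullet> (A *v x)) + v * (x \<bullet> (B *v x))"
      by (simp add: matrix_vector_mult_add_rdistrib inner_add_right flip: scaleR_matrix_vector_assoc)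
    also have "\<dots> > 0"
      using * PD_pos[OF *(1) that] PD_pos[OF *(2) that]
      by (cases "u = 0") (auto intro: add_pos_nonneg)
    finally show ?thesis .
  qed
  ultimately show "u *\<^sub>R A + v *\<^sub>R B \<in> PD"
    by (simp add: PD_def)
qed

text \<open>
  \<open>PD\<close> is connected, contains the identity, and the determinant has no zero on it.
\<close>

lemma PD_det_pos:
  fixes A :: "real^'m^'m"
  assumes "A \<in> PD"
  shows "det A > 0"
proof (rule ccontr)
  assume "\<not> det A > 0"
  have id: "(mat 1 :: real^'m^'m) \<in> PD"
    by (simp add: PD_def Sym_def transpose_mat)
  have "connected (PD :: (real^'m^'m) set)"
    using PD_convex convex_connected by blast
  then have "connected (det ` (PD :: (real^'m^'m) set))"
    using continuous_on_det connected_continuous_image by blast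
  moreover have "det A \<in> det ` (PD :: (real^'m^'m) set)" "1 \<in> det ` (PD :: (real^'m^'m) set)"
    using imageI[OF assms, of det] imageI[OF id, of det] by (simp_all)
  ultimately have "0 \<in> det ` (PD :: (real^'m^'m) set)"
    using \<open>\<not> det A > 0\<close> by (meson connectedD_interval not_less zero_le_one)
  then show False
    by (auto dest: PD_det_nonzero)
qed

text \<open>
  By compactness the form of \<open>A\<close> has a positive minimum \<open>c\<close> on the unit sphere, while the form of
  \<open>H\<close> is bounded there by its operator norm.
\<close>

lemma PD_open_in_Sym_along_lines:
  fixes A H :: "real^'m^'m"
  assumes "A \<in> PD" "H \<in> Sym"
  obtains e where "e > 0" "\<And>t. \<bar>t\<bar> < e \<Longrightarrow> A + t *\<^sub>R H \<in> PD"
proof -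
  let ?S = "sphere 0 1 :: (real^'m) set"
  have "?S \<noteq> {}" by (simp add: sphere_eq_empty)
  then obtain x0 where x0: "x0 \<in> ?S" "\<And>x. x \<in> ?S \<Longrightarrow> x0 \<bullet> (A *v x0) \<le> x \<bullet> (A *v x)"
    using continuous_attains_inf[of ?S "\<lambda>x. x \<bullet> (A *v x)"]
      continuous_on_inner[OF continuous_on_id linear_continuous_on[OF matrix_vector_mul_bounded_linear]]
    by (metis compact_sphere)
  define c where "c = x0 \<bullet> (A *v x0)"
  define M where "M = onorm ((*v) H)"
  have c: "c > 0" using x0(1) PD_pos[OF assms(1), of x0] unfolding c_def by fastforce
  have M: "M \<ge> 0" unfolding M_def by (simp add: onorm_pos_le)
  show ?thesis
  proof
    \<comment> \<open>The \<open>+ 1\<close> covers the case \<open>H = 0\<close>.\<close>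
    show "c / (M + 1) > 0" using c M by simp
    fix t assume t: "\<bar>t\<bar> < c / (M + 1)"
    have "x \<bullet> ((A + t *\<^sub>R H) *v x) > 0" if "x \<noteq> 0" for x
    proof -
      define u where "u = x /\<^sub>R norm x"
      have u: "norm u = 1" and x: "x = norm x *\<^sub>R u" using that by (auto simp: u_def)
      have "\<bar>u \<bullet> (H *v u)\<bar> \<le> norm u * norm (H *v u)" by (rule Cauchy_Schwarz_ineq2)
      also have "\<dots> \<le> M"
        using onorm[of "(*v) H" u] by (simp add: u M_def)
      finally have Hu: "\<bar>u \<bullet> (H *v u)\<bar> \<le> M" .
      have "\<bar>t * (u \<bullet> (H *v u))\<bar> \<le> \<bar>t\<bar> * (M + 1)"
        unfolding abs_mult using Hu by (intro mult_left_mono) auto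
      also have "\<dots> < c" using t M by (simp add: field_simps)
      finally have "u \<bullet> (A *v u) + t * (u \<bullet> (H *v u)) > 0"
        using x0(2)[of u] u by (simp add: c_def)
      moreover have "x \<bullet> ((A + t *\<^sub>R H) *v x) = norm x ^ 2 * (u \<bullet> (A *v u) + t * (u \<bullet> (H *v u)))"
        by (subst (1 2) x) (simp add: matrix_vector_mult_add_rdistrib inner_add_right power2_eq_square
            algebra_simps matrix_vector_mult_scaleR flip: scaleR_matrix_vector_assoc)
      ultimately show ?thesis using that by simp
    qed
    moreover have "A + t *\<^sub>R H \<in> Sym"
      using assms(2) PD_imp_Sym[OF assms(1)] by (intro subspace_add subspace_scale subspace_Sym)
    ultimately show "A + t *\<^sub>R H \<in> PD" by (simp add: PD_def)
  qed
qed

text \<open>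
  A spectral decomposition of \<open>P\<close> would reduce this to rank one, where
  \<open>tr (A v v\<^sup>T) = v\<^sup>T A v \<ge> 0\<close>. Peeling off one rank-one summand at a time avoids eigenvectors:
  if \<open>x\<^sup>T P x > 0\<close> and \<open>v = P x\<close>, then \<open>Q = P - v v\<^sup>T / (x\<^sup>T P x)\<close> is again positive
  semidefinite, and its kernel contains that of \<open>P\<close> and also \<open>x\<close>. The induction is therefore on
  the codimension of the kernel.
\<close>

lemma trace_mult_psd_nonneg:
  fixes A P :: "real^'m^'m"
  assumes A: "\<And>x. x \<bullet> (A *v x) \<ge> 0"
  assumes "P \<in> Sym" and "\<And>x. x \<bullet> (P *v x) \<ge> 0"
  shows "trace (A ** P) \<ge> 0"
  using assms(2,3)
proof (induction "CARD('m) - dim {x. P *v x = 0}" arbitrary: P rule: less_induct)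
  case less
  note Sym = Sym_inner[OF less.prems(1)] and psd = less.prems(2)
  show ?case
  proof (cases "\<forall>x. x \<bullet> (P *v x) = 0")
    case True
    \<comment> \<open>Polarization.\<close>
    have "y \<bullet> (P *v x) = 0" for x y
      using True[rule_format, of "x + y"] True[rule_format, of x] True[rule_format, of y] Sym[of x y]
      by (simp add: matrix_vector_right_distrib inner_add)
    then have "P *v x = 0" for x
      using inner_eq_zero_iff by blast
    then have "P = 0"
      by (simp add: matrix_eq)
    then show ?thesis by (simp add: trace_def matrix_matrix_mult_def)
  next
    case False
    then obtain x where x: "x \<bullet> (P *v x) > 0"
      using psd by (metis less_eq_real_def)
    define v where "v = P *v x"
    define c where "c = x \<bullet> v"
    have c: "c > 0" using x by (simp add: c_def v_def)
    define V :: "real^'m^'m" where "V = (\<chi> i j. v $ i * v $ j)"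
    define Q where "Q = P - (1 / c) *\<^sub>R V"
    have V_mult: "V *v y = (v \<bullet> y) *\<^sub>R v" for y
      by (simp add: V_def vec_eq_iff matrix_vector_mult_def inner_vec_def sum_distrib_right
          sum_distrib_left mult_ac)
    have Q_mult: "Q *v y = P *v y - ((v \<bullet> y) / c) *\<^sub>R v" for y
      by (simp add: Q_def matrix_vector_mult_diff_rdistrib V_mult flip: scaleR_matrix_vector_assoc)
    have Q_Sym: "Q \<in> Sym"
      unfolding Q_def using less.prems(1)
      by (intro subspace_diff subspace_scale subspace_Sym)
        (auto simp: V_def Sym_def transpose_def vec_eq_iff mult.commute)
    have vy: "v \<bullet> y = x \<bullet> (P *v y)" for y
      by (simp add: v_def Sym[of x y] inner_commute)
    have Q_psd: "y \<bullet> (Q *v y) \<ge> 0" for y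
    proof -
      \<comment> \<open>The value of \<open>s\<close> that minimizes the form of \<open>P\<close> on the line \<open>y - s x\<close>; the minimum
        is the form of \<open>Q\<close> at \<open>y\<close>.\<close>
      define s where "s = (v \<bullet> y) / c"
      have "0 \<le> (y - s *\<^sub>R x) \<bullet> (P *v (y - s *\<^sub>R x))" by (rule psd)
      also have "\<dots> = y \<bullet> (P *v y) - 2 * s * (v \<bullet> y) + s ^ 2 * c"
        by (simp add: matrix_vector_mult_diff_distrib matrix_vector_mult_scaleR inner_diff
            vy[symmetric] flip: v_def c_def) (simp add: c_def inner_commute power2_eq_square algebra_simps)
      also have "\<dots> = y \<bullet> (Q *v y)"
        using c by (simp add: Q_mult s_def inner_diff_right inner_commute power2_eq_square field_simps)
      finally show ?thesis .
    qed
    have "{y. P *v y = 0} \<subset> {y. Q *v y = 0}"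
    proof -
      have "Q *v x = 0" "P *v x \<noteq> 0"
        using c by (auto simp: Q_mult c_def inner_commute simp flip: v_def)
      then show ?thesis
        using c by (auto simp: Q_mult vy)
    qed
    moreover have "subspace {y. M *v y = 0}" for M :: "real^'m^'m"
      by (rule linear_subspace_kernel) simp
    ultimately have "dim {y. P *v y = 0} < dim {y. Q *v y = 0}"
      by (intro dim_psubset) (simp add: span_eq_iff[THEN iffD2])
    moreover have "dim {y. Q *v y = 0} \<le> CARD('m)"
      by (rule dim_subset_UNIV_cart)
    ultimately have "trace (A ** Q) \<ge> 0"
      by (intro less.hyps Q_Sym Q_psd) linarith
    moreover have "trace (A ** V) = v \<bullet> (A *v v)"
      by (simp add: trace_def matrix_matrix_mult_def V_def inner_vec_def matrix_vector_mult_def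
          sum_distrib_left mult_ac)
    moreover have "trace (A ** P) = trace (A ** Q) + (1 / c) * trace (A ** V)"
      by (simp add: Q_def matrix_mult_diff_right matrix_mult_scaleR_right trace_sub trace_scaleR)
    ultimately show ?thesis
      using A[of v] c by simp
  qed
qed

section \<open>The log-likelihood in the concentration coordinate\<close>

lemma matrix_inv_matrix_inv:
  fixes A :: "real^'m^'m"
  assumes "det A \<noteq> 0"
  shows "matrix_inv (matrix_inv A) = A"
  by (rule matrix_inv_unique[OF matrix_mult_inv_left[OF assms]])

lemma det_matrix_inv:
  fixes A :: "real^'m^'m"
  assumes "det A \<noteq> 0"
  shows "det (matrix_inv A) = 1 / det A"
  using arg_cong[OF matrix_mult_inv_right[OF assms], of det] assms
  by (simp add: det_mul field_simps)

lemma log_lik_matrix_inv: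
  assumes "A \<in> PD"
  shows "log_lik n (matrix_inv A) S = real n / 2 * (ln (det A) - trace (S ** A))"
  using PD_det_pos[OF assms]
  by (simp add: log_lik_def matrix_inv_matrix_inv det_matrix_inv ln_div right_diff_distrib)

lemma DERIV_ln_det_minus_trace:
  fixes A D S :: "real^'m^'m"
  assumes "A + t *\<^sub>R D \<in> PD"
  shows "((\<lambda>t. ln (det (A + t *\<^sub>R D)) - trace (S ** (A + t *\<^sub>R D))) has_real_derivative
           trace (matrix_inv (A + t *\<^sub>R D) ** D) - trace (S ** D)) (at t)"
proof -
  let ?X = "\<lambda>t. A + t *\<^sub>R D"
  note pos = PD_det_pos[OF assms]
  have X: "(?X has_derivative (\<lambda>h. h *\<^sub>R D)) (at t)"
    by (auto intro!: derivative_eq_intros)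
  have "((\<lambda>t. det (?X t)) has_derivative
      (\<lambda>h. det (?X t) * trace (matrix_inv (?X t) ** (h *\<^sub>R D)))) (at t)"
    by (rule has_derivative_compose[OF X Jacobi_formula]) (use pos in simp)
  then have "((\<lambda>t. det (?X t)) has_real_derivative
      det (?X t) * trace (matrix_inv (?X t) ** D)) (at t)"
    unfolding has_field_derivative_def
    by (rule has_derivative_eq_rhs) (simp add: fun_eq_iff matrix_mult_scaleR_right trace_scaleR)
  from DERIV_chain2[OF DERIV_ln_divide[OF pos] this]
  have 1: "((\<lambda>t. ln (det (?X t))) has_real_derivative trace (matrix_inv (?X t) ** D)) (at t)"
    using pos by simp
  have "((\<lambda>t. trace (S ** ?X t)) has_derivative (\<lambda>h. trace (S ** (h *\<^sub>R D)))) (at t)"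
    using has_derivative_trace[OF has_derivative_matrix_mult[OF has_derivative_const X]]
    by simp
  then have 2: "((\<lambda>t. trace (S ** ?X t)) has_real_derivative trace (S ** D)) (at t)"
    unfolding has_field_derivative_def
    by (rule has_derivative_eq_rhs) (simp add: fun_eq_iff matrix_mult_scaleR_right trace_scaleR)
  show ?thesis
    by (rule DERIV_diff[OF 1 2])
qed

text \<open>
  This is the concavity of \<open>ln det\<close>, stated as monotonicity of its derivative along a line. With
  \<open>M = A\<^sup>-\<^sup>1\<close> and \<open>N = (A + t D)\<^sup>-\<^sup>1\<close>, the resolvent identity \<open>M - N = t N D M\<close> shows that the
  two traces differ by \<open>t tr (N (D M D))\<close>, and \<open>D M D\<close> is positive semidefinite.
\<close>

lemma trace_matrix_inv_antimono:
  fixes A B :: "real^'m^'m"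
  assumes A: "A \<in> PD" and B: "A + t *\<^sub>R D \<in> PD" and "D \<in> Sym" "t \<ge> 0"
  shows "trace (matrix_inv (A + t *\<^sub>R D) ** D) \<le> trace (matrix_inv A ** D)"
proof -
  define M N where "M = matrix_inv A" and "N = matrix_inv (A + t *\<^sub>R D)"
  have M: "M \<in> PD" and N: "N \<in> PD"
    unfolding M_def N_def using A B by (auto intro: PD_matrix_inv)
  have AM: "A ** M = mat 1" and NB: "N ** (A + t *\<^sub>R D) = mat 1"
    unfolding M_def N_def
    by (rule matrix_mult_inv_right[OF PD_det_nonzero[OF A]],
        rule matrix_mult_inv_left[OF PD_det_nonzero[OF B]])
  have "M = N ** (A + t *\<^sub>R D) ** M"
    by (simp add: NB)
  also have "\<dots> = N ** (A ** M) + t *\<^sub>R (N ** D ** M)"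
    by (simp add: matrix_add_ldistrib matrix_mult_add_left matrix_mult_scaleR_left
        matrix_mult_scaleR_right matrix_mul_assoc)
  finally have "M = N + t *\<^sub>R (N ** D ** M)"
    by (simp add: AM)
  then have "trace (M ** D) = trace ((N + t *\<^sub>R (N ** D ** M)) ** D)"
    by simp
  also have "\<dots> = trace (N ** D) + t * trace (N ** (D ** M ** D))"
    by (simp add: matrix_mult_add_left matrix_mult_scaleR_left trace_add trace_scaleR matrix_mul_assoc)
  finally have eq: "trace (M ** D) = trace (N ** D) + t * trace (N ** (D ** M ** D))" .
  have "trace (N ** (D ** M ** D)) \<ge> 0"
  proof (rule trace_mult_psd_nonneg)
    show "D ** M ** D \<in> Sym"
      using SymD[OF \<open>D \<in> Sym\<close>] SymD[OF PD_imp_Sym[OF M]]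
      by (simp add: Sym_def matrix_transpose_mul matrix_mul_assoc)
    show "x \<bullet> ((D ** M ** D) *v x) \<ge> 0" for x
    proof -
      have "x \<bullet> ((D ** M ** D) *v x) = x \<bullet> (D *v (M *v (D *v x)))"
        by (simp add: matrix_vector_mul_assoc matrix_mul_assoc)
      also have "\<dots> = (D *v x) \<bullet> (M *v (D *v x))"
        by (simp add: inner_matrix_vector_left[of x D] SymD[OF \<open>D \<in> Sym\<close>])
      finally show ?thesis using PD_nonneg[OF M] by simp
    qed
  qed (rule PD_nonneg[OF N])
  then show ?thesis
    using eq \<open>t \<ge> 0\<close> unfolding M_def N_def by simp
qed

lemma ln_det_le_tangent:
  fixes A B :: "real^'m^'m"
  assumes A: "A \<in> PD" and B: "B \<in> PD"
  shows "ln (det B) - ln (det A) \<le> trace (matrix_inv A ** (B - A))"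
proof -
  define D where "D = B - A"
  have D: "D \<in> Sym"
    unfolding D_def using A B by (intro subspace_diff subspace_Sym PD_imp_Sym)
  have PD: "A + t *\<^sub>R D \<in> PD" if "0 \<le> t" "t \<le> 1" for t
  proof -
    have "A + t *\<^sub>R D = (1 - t) *\<^sub>R A + t *\<^sub>R B"
      by (simp add: D_def algebra_simps)
    then show ?thesis
      using convexD[OF PD_convex A B, of "1 - t" t] that by simp
  qed
  have "((\<lambda>t. ln (det (A + t *\<^sub>R D))) has_real_derivative trace (matrix_inv (A + t *\<^sub>R D) ** D)) (at t)"
    if "0 \<le> t" "t \<le> 1" for t
    \<comment> \<open>The derivative of \<open>ln det\<close> alone is the case \<open>S = 0\<close>.\<close>
    using DERIV_ln_det_minus_trace[OF PD[OF that], of 0] by (simp add: trace_def matrix_matrix_mult_def)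
  from MVT2[OF zero_less_one this] obtain z where z: "0 < z" "z < 1"
    and "ln (det (A + 1 *\<^sub>R D)) - ln (det (A + 0 *\<^sub>R D)) = (1 - 0) * trace (matrix_inv (A + z *\<^sub>R D) ** D)"
    by blast
  then have "ln (det B) - ln (det A) = trace (matrix_inv (A + z *\<^sub>R D) ** D)"
    by (simp add: D_def)
  also have "\<dots> \<le> trace (matrix_inv A ** D)"
    using z by (intro trace_matrix_inv_antimono A PD D) auto
  finally show ?thesis by (simp add: D_def)
qed

text \<open>
  Moving along \<open>A + t K\<close> with \<open>A = \<Sigma>\<^sup>-\<^sup>1\<close> gives the necessity of the trace conditions. Conversely,
  they allow \<open>\<Sigma>\<close> to be replaced by \<open>S\<close> in the tangent bound for \<open>ln det\<close> at \<open>A\<close>, because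
  \<open>B - A \<in> L\<close> for every other concentration matrix \<open>B\<close> of the model.
\<close>

lemma maximizer_iff_trace_eq:
  fixes L :: "(real^'m^'m) set"
  assumes "n > 0" "subspace L" "L \<subseteq> Sym" and \<Sigma>: "\<Sigma> \<in> concentration_model L"
  shows "(\<forall>\<Sigma>'\<in>concentration_model L. log_lik n \<Sigma>' S \<le> log_lik n \<Sigma> S)
    \<longleftrightarrow> (\<forall>K\<in>L. trace (S ** K) = trace (\<Sigma> ** K))"
    (is "?max \<longleftrightarrow> ?tr")
proof -
  define A where "A = matrix_inv \<Sigma>"
  have \<Sigma>PD: "\<Sigma> \<in> PD" and AL: "A \<in> L"
    using \<Sigma> by (auto simp: concentration_model_def A_def)
  have A: "A \<in> PD" and \<Sigma>A: "\<Sigma> = matrix_inv A"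
    using PD_matrix_inv[OF \<Sigma>PD] matrix_inv_matrix_inv[OF PD_det_nonzero[OF \<Sigma>PD]] by (auto simp: A_def)
  show ?thesis
  proof
    assume max: ?max
    show ?tr
    proof
      fix K assume K: "K \<in> L"
      obtain e where e: "e > 0" "\<And>t. \<bar>t\<bar> < e \<Longrightarrow> A + t *\<^sub>R K \<in> PD"
        using PD_open_in_Sym_along_lines[OF A] K assms(3) by blast
      let ?f = "\<lambda>t. ln (det (A + t *\<^sub>R K)) - trace (S ** (A + t *\<^sub>R K))"
      have "?f t \<le> ?f 0" if "\<bar>0 - t\<bar> < e" for t
      proof -
        have B: "A + t *\<^sub>R K \<in> PD" using e that by simp
        have "A + t *\<^sub>R K \<in> L"
          using AL K assms(2) by (intro subspace_add subspace_scale)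
        then have "matrix_inv (A + t *\<^sub>R K) \<in> concentration_model L"
          using B by (simp add: concentration_model_def PD_matrix_inv matrix_inv_matrix_inv PD_det_nonzero)
        from max[rule_format, OF this] show ?thesis
          using \<open>n > 0\<close> by (simp add: \<Sigma>A log_lik_matrix_inv A B)
      qed
      then have "trace (matrix_inv (A + 0 *\<^sub>R K) ** K) - trace (S ** K) = 0"
        using DERIV_local_max[OF DERIV_ln_det_minus_trace[of A 0 K S] e(1)] A by auto
      then show "trace (S ** K) = trace (\<Sigma> ** K)"
        by (simp add: \<Sigma>A)
    qed
  next
    assume tr: ?tr
    show ?max
    proof
      fix \<Sigma>' assume \<Sigma>': "\<Sigma>' \<in> concentration_model L"
      define B where "B = matrix_inv \<Sigma>'"
      have B: "B \<in> PD" and \<Sigma>'B: "\<Sigma>' = matrix_inv B" and BL: "B \<in> L"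
        using \<Sigma>'
        by (auto simp: B_def concentration_model_def PD_matrix_inv matrix_inv_matrix_inv PD_det_nonzero)
      have "ln (det B) - ln (det A) \<le> trace (\<Sigma> ** (B - A))"
        unfolding \<Sigma>A by (rule ln_det_le_tangent[OF A B])
      also have "\<dots> = trace (S ** (B - A))"
        using tr subspace_diff[OF assms(2) BL AL] by simp
      finally have "ln (det B) - trace (S ** B) \<le> ln (det A) - trace (S ** A)"
        by (simp add: matrix_mult_diff_right trace_sub)
      then show "log_lik n \<Sigma>' S \<le> log_lik n \<Sigma> S"
        unfolding \<Sigma>'B \<Sigma>A log_lik_matrix_inv[OF A] log_lik_matrix_inv[OF B]
        by (intro mult_left_mono) auto
    qed
  qed
qed

section \<open>Gradient, tangent space and critical points\<close>

lemma has_sym_gradient_log_lik: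
  fixes \<Sigma> S :: "real^'m^'m"
  assumes \<Sigma>: "\<Sigma> \<in> PD" and S: "S \<in> Sym"
  shows "has_sym_gradient (\<lambda>X. log_lik n X S)
    (- (real n / 2) *\<^sub>R (matrix_inv \<Sigma> - matrix_inv \<Sigma> ** S ** matrix_inv \<Sigma>)) \<Sigma>"
proof -
  define A where "A = matrix_inv \<Sigma>"
  note pos = PD_det_pos[OF \<Sigma>]
  have A: "A \<in> Sym"
    unfolding A_def by (intro PD_imp_Sym PD_matrix_inv \<Sigma>)
  have "A ** S ** A \<in> Sym"
    using SymD[OF A] SymD[OF S] by (simp add: Sym_def matrix_transpose_mul matrix_mul_assoc)
  then have "- (real n / 2) *\<^sub>R (A - A ** S ** A) \<in> Sym"
    by (intro subspace_scale subspace_diff subspace_Sym A)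
  moreover have "((\<lambda>X. log_lik n X S) has_derivative
      (\<lambda>H. trace ((- (real n / 2) *\<^sub>R (A - A ** S ** A)) ** H))) (at \<Sigma> within PD)"
  proof -
    have det: "((\<lambda>X. ln (det X)) has_derivative (\<lambda>H. trace (A ** H))) (at \<Sigma>)"
      using has_derivative_ln[OF pos Jacobi_formula] pos
      by (auto simp: A_def elim!: has_derivative_eq_rhs)
    have tr: "((\<lambda>X. trace (S ** matrix_inv X)) has_derivative (\<lambda>H. - trace (S ** (A ** H ** A)))) (at \<Sigma>)"
      using has_derivative_trace[OF has_derivative_matrix_mult[OF has_derivative_const
            has_derivative_matrix_inv[of \<Sigma>]]] pos
      by (simp add: A_def matrix_mult_uminus_right trace_uminus)
    have "((\<lambda>X. log_lik n X S) has_derivative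
        (\<lambda>H. - (real n / 2) * trace (A ** H) - (real n / 2) * - trace (S ** (A ** H ** A)))) (at \<Sigma>)"
      unfolding log_lik_def
      by (intro has_derivative_diff has_derivative_mult_right det tr)
    moreover have "trace (S ** (A ** H ** A)) = trace (A ** S ** A ** H)" for H
      using trace_mul_sym[of "S ** A ** H" A] by (simp add: matrix_mul_assoc)
    ultimately have "((\<lambda>X. log_lik n X S) has_derivative
        (\<lambda>H. trace ((- (real n / 2) *\<^sub>R (A - A ** S ** A)) ** H))) (at \<Sigma>)"
      by (simp add: matrix_mult_scaleR_left matrix_mult_diff_left trace_scaleR trace_sub
          matrix_mult_uminus_left trace_uminus right_diff_distrib)
    then show ?thesis
      by (rule has_derivative_at_withinI)
  qed
  ultimately show ?thesis
    by (simp add: has_sym_gradient_def A_def)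
qed

lemma trace_transpose_mult:
  fixes A B :: "real^'n^'m"
  shows "trace (transpose A ** B) = A \<bullet> B"
  unfolding trace_def matrix_matrix_mult_def transpose_def inner_vec_def
  by simp (rule sum.swap)

text \<open>
  A derivative within \<open>PD\<close> is determined only in the directions in which \<open>PD\<close> extends, the symmetric
  ones. The difference \<open>T\<close> of two symmetric gradients is such a direction, and testing both gradients
  on \<open>T\<close> itself gives \<open>tr (T T) = 0\<close>, the squared Euclidean norm of \<open>T\<close>.
\<close>

lemma has_sym_gradient_unique:
  fixes \<Sigma> :: "real^'m^'m"
  assumes G: "has_sym_gradient f G \<Sigma>" and G': "has_sym_gradient f G' \<Sigma>" and \<Sigma>: "\<Sigma> \<in> PD"
  shows "G = G'"
proof -
  define T where "T = G - G'"
  have T: "T \<in> Sym"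
    using G G' unfolding T_def has_sym_gradient_def by (intro subspace_diff subspace_Sym) auto
  obtain e where e: "e > 0" "\<And>t. \<bar>t\<bar> < e \<Longrightarrow> \<Sigma> + t *\<^sub>R T \<in> PD"
    using PD_open_in_Sym_along_lines[OF \<Sigma> T] by blast
  have line: "((\<lambda>t. f (\<Sigma> + t *\<^sub>R T)) has_derivative (\<lambda>h. trace (X ** (h *\<^sub>R T)))) (at 0)"
    if "has_sym_gradient f X \<Sigma>" for X
  proof -
    let ?I = "{-e<..<e}"
    have sub: "(\<lambda>t. \<Sigma> + t *\<^sub>R T) ` ?I \<subseteq> PD" using e(2) by auto
    have aff: "((\<lambda>t. \<Sigma> + t *\<^sub>R T) has_derivative (\<lambda>h. h *\<^sub>R T)) (at 0 within ?I)"
      by (auto intro!: derivative_eq_intros)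
    have "(f has_derivative (\<lambda>H. trace (X ** H))) (at (\<Sigma> + 0 *\<^sub>R T) within PD)"
      using that by (simp add: has_sym_gradient_def)
    from has_derivative_in_compose[OF aff has_derivative_subset[OF this sub]] have "((\<lambda>t. f (\<Sigma> + t *\<^sub>R T)) has_derivative (\<lambda>h. trace (X ** (h *\<^sub>R T)))) (at 0 within ?I)" .
    then show ?thesis
      using e(1) by (simp add: at_within_open[of 0 ?I])
  qed
  have "trace (G ** T) = trace (G' ** T)"
    using has_derivative_unique[OF line[OF G] line[OF G']] by (simp add: fun_eq_iff) (metis scaleR_one)
  then have "trace (T ** T) = 0"
    by (simp add: T_def matrix_mult_diff_left trace_sub)
  moreover have "trace (T ** T) = T \<bullet> T"
    using trace_transpose_mult[of T T] by (simp add: SymD[OF T])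
  ultimately have "T = 0" by simp
  then show ?thesis by (simp add: T_def)
qed

text \<open>
  The difference quotients lie in the subspace, which is closed.
\<close>

lemma vector_derivative_in_subspace:
  fixes g :: "real \<Rightarrow> 'a::euclidean_space"
  assumes L: "subspace L" and g: "(g has_vector_derivative D) (at 0)"
    and "\<forall>\<^sub>F t in at 0. g t \<in> L" and "g 0 \<in> L"
  shows "D \<in> L"
proof -
  have "(\<lambda>t. norm (g t - g 0 - t *\<^sub>R D) / norm t) \<midarrow>0\<rightarrow> 0"
    using g by (simp add: has_vector_derivative_def has_derivative_at)
  moreover have "\<forall>\<^sub>F t in at 0. norm (g t - g 0 - t *\<^sub>R D) / norm t = norm ((g t - g 0) /\<^sub>R t - D)"
  proof (rule eventually_at_filter[THEN iffD2], rule always_eventually, intro allI impI)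
    fix t :: real assume "t \<noteq> 0"
    then have "(g t - g 0) /\<^sub>R t - D = (g t - g 0 - t *\<^sub>R D) /\<^sub>R t"
      by (simp add: scaleR_right_diff_distrib)
    then show "norm (g t - g 0 - t *\<^sub>R D) / norm t = norm ((g t - g 0) /\<^sub>R t - D)"
      by (simp add: divide_inverse mult.commute)
  qed
  ultimately have "(\<lambda>t. norm ((g t - g 0) /\<^sub>R t - D)) \<midarrow>0\<rightarrow> 0"
    by (rule Lim_transform_eventually)
  then have lim: "(\<lambda>t. (g t - g 0) /\<^sub>R t) \<midarrow>0\<rightarrow> D"
    by (rule LIM_zero_cancel[OF tendsto_norm_zero_cancel])
  have "\<forall>\<^sub>F t in at 0. (g t - g 0) /\<^sub>R t \<in> L"
    using assms(3) by eventually_elim (intro subspace_scale subspace_diff L assms(4))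
  then show ?thesis
    by (rule Lim_in_closed_set[OF closed_subspace[OF L] _ trivial_limit_at lim])
qed

text \<open>
  Matrix inversion maps curves in the model to curves in \<open>L\<close>, whose velocities stay in \<open>L\<close>; this
  gives one inclusion. For the other, the velocity \<open>-\<Sigma> K \<Sigma>\<close> is realized by inverting the line
  \<open>\<Sigma>\<^sup>-\<^sup>1 + t K\<close>.
\<close>

lemma tangent_space_concentration_model:
  fixes L :: "(real^'m^'m) set"
  assumes L: "subspace L" "L \<subseteq> Sym" and \<Sigma>: "\<Sigma> \<in> concentration_model L"
  shows "tangent_space (concentration_model L) \<Sigma> = (\<lambda>K. - (\<Sigma> ** K ** \<Sigma>)) ` L"
proof -
  define A where "A = matrix_inv \<Sigma>"
  have \<Sigma>PD: "\<Sigma> \<in> PD" and AL: "A \<in> L"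
    using \<Sigma> by (auto simp: concentration_model_def A_def)
  have A: "A \<in> PD" and \<Sigma>A: "matrix_inv A = \<Sigma>"
    using PD_matrix_inv[OF \<Sigma>PD] matrix_inv_matrix_inv[OF PD_det_nonzero[OF \<Sigma>PD]] by (auto simp: A_def)
  have inv: "\<Sigma> ** A = mat 1" "A ** \<Sigma> = mat 1"
    unfolding A_def using PD_det_nonzero[OF \<Sigma>PD] by (simp_all add: matrix_mult_inv_right matrix_mult_inv_left)
  show ?thesis
  proof (intro equalityI subsetI)
    fix T assume "T \<in> tangent_space (concentration_model L) \<Sigma>"
    then obtain \<gamma> :: "real \<Rightarrow> real^'m^'m" and e where T: "T = vector_derivative \<gamma> (at 0)"
      and \<gamma>0: "\<gamma> 0 = \<Sigma>" and e: "e > 0" and C1: "\<gamma> C1_differentiable_on {-e<..<e}"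
      and sub: "\<gamma> ` {-e<..<e} \<subseteq> concentration_model L"
      unfolding tangent_space_def by blast
    have "\<gamma> differentiable (at 0)"
      using C1 e unfolding C1_differentiable_on_eq by auto
    then have "(\<gamma> has_vector_derivative T) (at 0)"
      unfolding T by (rule vector_derivative_works[THEN iffD1])
    then have \<gamma>: "(\<gamma> has_derivative (\<lambda>h. h *\<^sub>R T)) (at 0)"
      by (simp add: has_vector_derivative_def)
    have "((\<lambda>t. matrix_inv (\<gamma> t)) has_derivative (\<lambda>h. - (A ** (h *\<^sub>R T) ** A))) (at 0)"
      using has_derivative_compose[OF \<gamma>, of matrix_inv, unfolded \<gamma>0,
          OF has_derivative_matrix_inv[OF PD_det_nonzero[OF \<Sigma>PD]]]
      unfolding A_def .
    then have "((\<lambda>t. matrix_inv (\<gamma> t)) has_vector_derivative - (A ** T ** A)) (at 0)"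
      by (simp add: has_vector_derivative_def matrix_mult_scaleR_left matrix_mult_scaleR_right)
    moreover have "\<forall>\<^sub>F t in at 0. matrix_inv (\<gamma> t) \<in> L"
    proof (rule eventually_mono)
      show "\<forall>\<^sub>F t in at 0. t \<in> {-e<..<e}"
        using e by (intro eventually_at_in_open') auto
      show "matrix_inv (\<gamma> t) \<in> L" if "t \<in> {-e<..<e}" for t
        using subsetD[OF sub imageI[OF that]] by (simp add: concentration_model_def)
    qed
    ultimately have "- (A ** T ** A) \<in> L"
      by (rule vector_derivative_in_subspace[OF L(1)]) (simp add: \<gamma>0 AL flip: A_def)
    moreover have "T = - (\<Sigma> ** - (A ** T ** A) ** \<Sigma>)"
    proof -
      have "\<Sigma> ** (A ** T ** A) ** \<Sigma> = (\<Sigma> ** A) ** T ** (A ** \<Sigma>)"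
        by (simp only: matrix_mul_assoc)
      then show ?thesis
        by (simp add: inv matrix_mult_uminus_left matrix_mult_uminus_right)
    qed
    ultimately show "T \<in> (\<lambda>K. - (\<Sigma> ** K ** \<Sigma>)) ` L"
      by blast
  next
    fix T assume "T \<in> (\<lambda>K. - (\<Sigma> ** K ** \<Sigma>)) ` L"
    then obtain K where K: "K \<in> L" and T: "T = - (\<Sigma> ** K ** \<Sigma>)" by blast
    obtain e where e: "e > 0" "\<And>t. \<bar>t\<bar> < e \<Longrightarrow> A + t *\<^sub>R K \<in> PD"
      using PD_open_in_Sym_along_lines[OF A] K L(2) by blast
    define \<gamma> where "\<gamma> t = matrix_inv (A + t *\<^sub>R K)" for t
    let ?I = "{-e<..<e}"
    have PD: "A + t *\<^sub>R K \<in> PD" if "t \<in> ?I" for t using e(2) that by auto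
    have deriv: "(\<gamma> has_vector_derivative - (\<gamma> t ** K ** \<gamma> t)) (at t)" if "t \<in> ?I" for t
    proof -
      have "((\<lambda>t. A + t *\<^sub>R K) has_derivative (\<lambda>h. h *\<^sub>R K)) (at t)"
        by (auto intro!: derivative_eq_intros)
      from has_derivative_compose[OF this has_derivative_matrix_inv[OF PD_det_nonzero[OF PD[OF that]]]]
      show ?thesis
        by (simp add: \<gamma>_def[abs_def] has_vector_derivative_def matrix_mult_scaleR_left matrix_mult_scaleR_right)
    qed
    have "continuous_on ?I \<gamma>"
      by (intro continuous_at_imp_continuous_on ballI has_vector_derivative_continuous[OF deriv])
    then have "continuous_on ?I (\<lambda>t. - (\<gamma> t ** K ** \<gamma> t))"
      by (intro continuous_on_minus bounded_bilinear.continuous_on[OF bounded_bilinear_matrix_mult]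
          continuous_on_const)
    with deriv have C1: "\<gamma> C1_differentiable_on ?I"
      unfolding C1_differentiable_on_def by (intro exI[of _ "\<lambda>t. - (\<gamma> t ** K ** \<gamma> t)"]) simp
    have sub: "\<gamma> ` ?I \<subseteq> concentration_model L"
    proof
      fix X assume "X \<in> \<gamma> ` ?I"
      then obtain t where t: "t \<in> ?I" and X: "X = \<gamma> t" by blast
      have "A + t *\<^sub>R K \<in> L"
        using AL K L(1) by (intro subspace_add subspace_scale)
      then show "X \<in> concentration_model L"
        using PD[OF t] by (simp add: X \<gamma>_def concentration_model_def PD_matrix_inv
            matrix_inv_matrix_inv PD_det_nonzero)
    qed
    have \<gamma>0: "\<gamma> 0 = \<Sigma>" by (simp add: \<gamma>_def \<Sigma>A)
    have "vector_derivative \<gamma> (at 0) = T"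
      using deriv[of 0] e(1) by (simp add: \<gamma>0 T vector_derivative_at)
    then show "T \<in> tangent_space (concentration_model L) \<Sigma>"
      unfolding tangent_space_def mem_Collect_eq
      using e(1) C1 sub \<gamma>0 by (intro exI[of _ \<gamma>]) auto
  qed
qed

text \<open>
  The gradient is unique, so criticality means that the explicit gradient \<open>G\<close> is orthogonal to every
  tangent vector \<open>-\<Sigma> K \<Sigma>\<close>.
\<close>

lemma critical_point_iff_trace_eq:
  fixes L :: "(real^'m^'m) set"
  assumes "n > 0" and L: "subspace L" "L \<subseteq> Sym" and \<Sigma>: "\<Sigma> \<in> concentration_model L" and S: "S \<in> Sym"
  shows "critical_point (\<lambda>X. log_lik n X S) (concentration_model L) \<Sigma>
    \<longleftrightarrow> (\<forall>K\<in>L. trace (S ** K) = trace (\<Sigma> ** K))"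
proof -
  define A where "A = matrix_inv \<Sigma>"
  define G where "G = - (real n / 2) *\<^sub>R (A - A ** S ** A)"
  have \<Sigma>PD: "\<Sigma> \<in> PD"
    using \<Sigma> by (auto simp: concentration_model_def)
  have inv: "\<Sigma> ** A = mat 1" "A ** \<Sigma> = mat 1"
    unfolding A_def using PD_det_nonzero[OF \<Sigma>PD] by (simp_all add: matrix_mult_inv_right matrix_mult_inv_left)
  have grad: "has_sym_gradient (\<lambda>X. log_lik n X S) G \<Sigma>"
    unfolding G_def A_def by (rule has_sym_gradient_log_lik[OF \<Sigma>PD S])
  have "critical_point (\<lambda>X. log_lik n X S) (concentration_model L) \<Sigma>
      \<longleftrightarrow> G \<in> normal_space (concentration_model L) \<Sigma>"
    unfolding critical_point_def using \<Sigma> grad has_sym_gradient_unique[OF _ grad \<Sigma>PD] by blast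
  also have "\<dots> \<longleftrightarrow> (\<forall>K\<in>L. trace (G ** - (\<Sigma> ** K ** \<Sigma>)) = 0)"
    using grad unfolding normal_space_def tangent_space_concentration_model[OF L \<Sigma>] has_sym_gradient_def
    by auto
  also have "\<dots> \<longleftrightarrow> (\<forall>K\<in>L. trace (S ** K) = trace (\<Sigma> ** K))"
  proof -
    have trG: "trace (G ** - (\<Sigma> ** K ** \<Sigma>)) = real n / 2 * (trace (\<Sigma> ** K) - trace (S ** K))" for K
    proof -
      have "trace (A ** (\<Sigma> ** K ** \<Sigma>)) = trace (\<Sigma> ** K)"
        using trace_mul_sym[of K \<Sigma>] by (simp add: matrix_mul_assoc inv)
      moreover have "trace (A ** S ** A ** (\<Sigma> ** K ** \<Sigma>)) = trace (S ** K)"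
      proof -
        have "A ** S ** A ** (\<Sigma> ** K ** \<Sigma>) = A ** (S ** (A ** \<Sigma>) ** K ** \<Sigma>)"
          by (simp only: matrix_mul_assoc)
        then have "trace (A ** S ** A ** (\<Sigma> ** K ** \<Sigma>)) = trace ((S ** K ** \<Sigma>) ** A)"
          by (simp add: inv trace_mul_sym[of A])
        also have "(S ** K ** \<Sigma>) ** A = S ** K ** (\<Sigma> ** A)"
          by (simp only: matrix_mul_assoc)
        finally show ?thesis by (simp add: inv)
      qed
      ultimately show ?thesis
        by (simp add: G_def matrix_mult_uminus_left matrix_mult_uminus_right matrix_mult_scaleR_left
            matrix_mult_diff_left trace_uminus trace_scaleR trace_sub)
    qed
    show ?thesis
      unfolding trG using \<open>n > 0\<close> by auto
  qed
  finally show ?thesis .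
qed

lemma trace_eq_on_span_iff:
  fixes S \<Sigma> :: "real^'m^'m"
  shows "(\<forall>X\<in>span B. trace (S ** X) = trace (\<Sigma> ** X)) \<longleftrightarrow> (\<forall>X\<in>B. trace (S ** X) = trace (\<Sigma> ** X))"
proof
  assume eq: "\<forall>X\<in>B. trace (S ** X) = trace (\<Sigma> ** X)"
  have "subspace {X. trace (S ** X) = trace (\<Sigma> ** X)}"
    by (auto simp: subspace_def matrix_add_ldistrib trace_add matrix_mult_scaleR_right trace_scaleR)
  then show "\<forall>X\<in>span B. trace (S ** X) = trace (\<Sigma> ** X)"
    using eq span_minimal[of B "{X. trace (S ** X) = trace (\<Sigma> ** X)}"] by blast
qed (simp add: span_base)

theorem proposition3p1:
  fixes n d :: nat
    and K :: "nat \<Rightarrow> real^'m^'m"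
    and L :: "(real^'m^'m) set"
    and \<Theta> :: "(real^'m^'m) set"
    and \<Sigma> :: "real^'m^'m"
  assumes "n > 0"
    and "subspace L" and "L \<subseteq> Sym" and "dim L = d"
    and "inj_on K {1..d}" and "independent (K ` {1..d})" and "span (K ` {1..d}) = L"
    and "\<Theta> = concentration_model L"
    and "\<Sigma> \<in> \<Theta>"
  shows "log_Vor n \<Theta> \<Sigma> = log_normal_spectrahedron n \<Theta> \<Sigma> \<and>
         log_normal_spectrahedron n \<Theta> \<Sigma> =
           {S \<in> PD. \<forall>j\<in>{1..d}. trace (S ** K j) = trace (\<Sigma> ** K j)}"
proof -
  have model: "\<Sigma> \<in> concentration_model L"
    using \<open>\<Theta> = concentration_model L\<close> \<open>\<Sigma> \<in> \<Theta>\<close> by simp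
  have "log_Vor n \<Theta> \<Sigma> = {S \<in> PD. \<forall>K\<in>L. trace (S ** K) = trace (\<Sigma> ** K)}"
    using maximizer_iff_trace_eq[OF \<open>n > 0\<close> \<open>subspace L\<close> \<open>L \<subseteq> Sym\<close> model]
    by (simp add: log_Vor_def \<open>\<Theta> = concentration_model L\<close>)
  moreover have "log_normal_spectrahedron n \<Theta> \<Sigma> = {S \<in> PD. \<forall>K\<in>L. trace (S ** K) = trace (\<Sigma> ** K)}"
    using critical_point_iff_trace_eq[OF \<open>n > 0\<close> \<open>subspace L\<close> \<open>L \<subseteq> Sym\<close> model]
    by (auto simp: log_normal_spectrahedron_def log_normal_space_def PD_imp_Sym
        \<open>\<Theta> = concentration_model L\<close>)
  moreover have "(\<forall>X\<in>L. trace (S ** X) = trace (\<Sigma> ** X))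
      \<longleftrightarrow> (\<forall>j\<in>{1..d}. trace (S ** K j) = trace (\<Sigma> ** K j))" for S
    using trace_eq_on_span_iff[of "K ` {1..d}" S \<Sigma>] \<open>span (K ` {1..d}) = L\<close> by simp
  ultimately show ?thesis by simp
qed

end
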